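(* If $(X,\sigma)$ is a non-degenerate rank-1 system and $\tau$ is an autohomeomorphism of $X$ that commutes with $\sigma$, then $\tau=\sigma^i$ for some $i\in\mathbb{Z}$.
   Context: $\mathbb{N}$ includes $0$. $\mathcal{F}$ is the set of nonempty finite words over $\{0,1\}$ that begin and end with $0$. Juxtaposition denotes concatenation and $1^a$ is the word consisting of $a$ ones. An infinite word $V\in\{0,1\}^{\mathbb{N}}$ is built from $v\in\mathcal{F}$ if there is a sequence $(a_i)_{i\ge 1}$ of natural numbers with $V=v1^{a_1}v1^{a_2}v\cdots$. $V$ is rank-1 if it is built from infinitely many $v\in\mathcal{F}$. A rank-1 word $V$ is degenerate if $V=vvv\cdots$ for some finite word $v$, and non-degenerate otherwise. The rank-1 system associated to a rank-1 word $V$ is $(X,\sigma)$, where $X=\{x\in\{0,1\}^{\mathbb{Z}} : \text{every finite subword of } x \text{ is a subword of } V\}$ (with the subspace topology of the product topology) and $\sigma(x)(i)=x(i+1)$. A non-degenerate rank-1 system is the rank-1 system associated to a non-degenerate rank-1 word. *)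

theory Defs
  imports "HOL-Analysis.Analysis" "HOL-Library.Omega_Words_Fun"
begin

text \<open>
  The alphabet is \<^typ>\<open>bool\<close>, with \<^const>\<open>False\<close> for the letter 0 and
  \<^const>\<open>True\<close> for the letter 1. Finite words are lists, infinite words are functions on
  \<^typ>\<open>nat\<close> and bi-infinite words are functions on \<^typ>\<open>int\<close>. The type class topology of
  \<open>int \<Rightarrow> bool\<close> is the product topology of the discrete topology on \<^typ>\<open>bool\<close>.
\<close>

definition base_words :: "bool list set" where
  "base_words = {v. v \<noteq> [] \<and> hd v = False \<and> last v = False}"

text \<open>
  The infinite concatenation $v 1^{a_1} v 1^{a_2} v \cdots$ is described by its finite
  initial parts, which determine it because \<open>v\<close> is nonempty.
\<close>

definition built_from :: "bool word \<Rightarrow> bool list \<Rightarrow> bool" where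
  "built_from V v \<longleftrightarrow> v \<in> base_words \<and>
     (\<exists>a :: nat \<Rightarrow> nat. \<forall>n. \<exists>W.
        V = concat (map (\<lambda>i. v @ replicate (a i) True) [1..<Suc n]) \<frown> W)"

definition rank1_word :: "bool word \<Rightarrow> bool" where
  "rank1_word V \<longleftrightarrow> infinite {v. built_from V v}"

definition degenerate :: "bool word \<Rightarrow> bool" where
  "degenerate V \<longleftrightarrow> (\<exists>v. v \<noteq> [] \<and> V = v\<^sup>\<omega>)"

definition subwords :: "'a word \<Rightarrow> 'a list set" where
  "subwords V = {V [i \<rightarrow> j] | i j. True}"

definition bi_subwords :: "(int \<Rightarrow> 'a) \<Rightarrow> 'a list set" where
  "bi_subwords x = {map x [i..j] | i j. True}"

definition rank1_system :: "bool word \<Rightarrow> (int \<Rightarrow> bool) set" where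
  "rank1_system V = {x. bi_subwords x \<subseteq> subwords V}"

definition nondegenerate_rank1_system :: "(int \<Rightarrow> bool) set \<Rightarrow> bool" where
  "nondegenerate_rank1_system X \<longleftrightarrow>
     (\<exists>V. rank1_word V \<and> \<not> degenerate V \<and> X = rank1_system V)"

definition shift :: "(int \<Rightarrow> 'a) \<Rightarrow> (int \<Rightarrow> 'a)" where
  "shift x = (\<lambda>i. x (i + 1))"

definition int_iterate :: "('a \<Rightarrow> 'a) \<Rightarrow> int \<Rightarrow> 'a \<Rightarrow> 'a" where
  "int_iterate f i = (if 0 \<le> i then f ^^ nat i else inv f ^^ nat (- i))"

lemma inv_shift: "inv shift x = (\<lambda>i. x (i - 1))"
proof (rule inv_f_eq)
  show "inj shift"
    unfolding inj_def shift_def fun_eq_iff by (metis diff_add_cancel)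
qed (simp add: shift_def)

lemma int_iterate_shift: "int_iterate shift i x = (\<lambda>j. x (j + i))"
proof -
  have "(shift ^^ n) x = (\<lambda>j. x (j + int n))" for n
    by (induction n) (simp_all add: shift_def algebra_simps)
  moreover have "(inv shift ^^ n) x = (\<lambda>j. x (j - int n))" for n
    by (induction n) (simp_all add: inv_shift algebra_simps)
  ultimately show ?thesis
    by (simp add: int_iterate_def)
qed

text \<open>
  Since the system is invariant under all powers of the shift, those powers may be computed
  on the full space of bi-infinite words.
\<close>

lemma int_iterate_shift_in_system:
  assumes "x \<in> rank1_system V"
  shows "int_iterate shift k x \<in> rank1_system V"
proof -
  have "map (\<lambda>j. x (j + k)) [i..j] = map x [i + k..j + k]" for i j
    by (rule nth_equalityI) (simp_all add: algebra_simps)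
  then have "bi_subwords (int_iterate shift k x) \<subseteq> bi_subwords x"
    by (auto simp: bi_subwords_def int_iterate_shift)
  with assms show ?thesis
    by (auto simp: rank1_system_def)
qed

end

theory Submission
  imports Defs
begin

text \<open>
  If \<open>V\<close> has arbitrarily long runs of ones, the constant word 1 lies in \<open>X\<close>. It is fixed by
  \<open>\<tau>\<close>, and the only points left asymptotic to it are itself and the translates of
  \<open>\<dots>111V\<close>, so \<open>\<tau>\<close> maps \<open>\<dots>111V\<close> to one of its translates. Otherwise there are two
  different points of \<open>X\<close> that continue with \<open>V\<close> to the right of the origin. Their images are
  different and right asymptotic, and any two such points continue with a translate of \<open>V\<close>:
  for each word \<open>v\<close> from which \<open>V\<close> is built, the decompositions of the two points into copies
  of \<open>v\<close> and ones are eventually aligned (overlapping unaligned ones have constant spacers and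
  make \<open>V\<close> periodic), so the points first differ inside a spacer, just before a copy of \<open>v\<close>.
  In both cases \<open>\<tau>\<close> agrees with a power of the shift on a tail with a dense orbit, and the local
  rule of \<open>\<tau>\<close> extends this to \<open>X\<close>.
\<close>

section \<open>Compactness of the full shift\<close>

lemma compact_UNIV_bool_fun: "compact (UNIV :: ('a \<Rightarrow> bool) set)"
proof -
  have "compact_space (euclidean :: bool topology)"
    by (simp add: compact_space_def finite_imp_compact)
  then have "compact_space (product_topology (\<lambda>i :: 'a. euclidean :: bool topology) UNIV)"
    by (simp add: compact_space_product_topology)
  then show ?thesis
    by (metis compact_space_def compactin_euclidean_iff euclidean_product_topology topspace_euclidean)
qed

section \<open>Cylinders and sets determined by finitely many coordinates\<close>

definition agree :: "int set \<Rightarrow> (int \<Rightarrow> bool) \<Rightarrow> (int \<Rightarrow> bool) \<Rightarrow> bool" where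
  "agree F x y \<longleftrightarrow> (\<forall>m\<in>F. x m = y m)"

lemma open_cylinder:
  assumes "finite F"
  shows "open {y. agree F x y}"
proof -
  have "open {y :: int \<Rightarrow> bool. y m = x m}" for m
  proof -
    have "open ((\<lambda>y :: int \<Rightarrow> bool. y m) -` {x m})"
      by (intro open_vimage open_discrete continuous_on_product_coordinates)
    then show ?thesis by (simp add: vimage_def)
  qed
  then have "open (\<Inter>m\<in>F. {y. y m = x m})"
    using assms by (intro open_INT) auto
  also have "(\<Inter>m\<in>F. {y. y m = x m}) = {y. agree F x y}"
    by (auto simp: agree_def)
  finally show ?thesis .
qed

text \<open>The cylinder on \<open>F\<close> around a point outside \<open>K\<close> stays outside
  \<open>K\<close>.\<close>

lemma closed_finitely_determined:
  assumes "finite F" and "\<And>x y. agree F x y \<Longrightarrow> x \<in> K \<Longrightarrow> y \<in> K"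
  shows "closed K"
proof -
  have "open (- K)"
  proof (subst open_subopen, intro ballI)
    fix x assume "x \<in> - K"
    moreover have "agree F y x" if "agree F x y" for y
      using that by (auto simp: agree_def)
    ultimately have "{y. agree F x y} \<subseteq> - K"
      using assms(2) by blast
    moreover have "x \<in> {y. agree F x y}"
      by (simp add: agree_def)
    ultimately show "\<exists>T. open T \<and> x \<in> T \<and> T \<subseteq> - K"
      using open_cylinder[OF assms(1)] by blast
  qed
  then show ?thesis by (simp add: closed_def)
qed

text \<open>Cantor's intersection theorem; it yields parses and limit points from finite
  approximations.\<close>

lemma nested_closed_INT_nonempty:
  fixes K :: "nat \<Rightarrow> (int \<Rightarrow> bool) set"
  assumes "\<And>n. closed (K n)" "\<And>n. K n \<noteq> {}" "\<And>n. K (Suc n) \<subseteq> K n"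
  shows "\<exists>x. \<forall>n. x \<in> K n"
proof -
  have mono: "K n \<subseteq> K m" if "m \<le> n" for m n
    using that by (rule lift_Suc_antimono_le[where f = K, OF assms(3)])
  have "UNIV \<inter> (\<Inter>n\<in>UNIV. K n) \<noteq> {}"
  proof (rule compact_imp_fip_image[OF compact_UNIV_bool_fun])
    fix I :: "nat set" assume "finite I"
    then have "K (Max (insert 0 I)) \<subseteq> (\<Inter>n\<in>I. K n)"
      by (intro INT_greatest mono) simp
    then show "UNIV \<inter> (\<Inter>n\<in>I. K n) \<noteq> {}"
      using assms(2) by fastforce
  qed (use assms in auto)
  then show ?thesis by auto
qed

text \<open>The Curtis-Hedlund-Lyndon argument: near each point, coordinate 0 of the image depends
  on a finite window, and compactness of \<open>X\<close> bounds the window sizes by one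
  \<open>R\<close>.\<close>

lemma sliding_block_code:
  fixes \<tau> :: "(int \<Rightarrow> bool) \<Rightarrow> int \<Rightarrow> bool"
  assumes "closed X" and cont: "continuous_on X \<tau>"
  shows "\<exists>R. \<forall>y\<in>X. \<forall>z\<in>X. agree {- int R..int R} y z \<longrightarrow> \<tau> y 0 = \<tau> z 0"
proof -
  define C where "C y N = {z. agree {- int N..int N} y z}" for y N
  have "\<exists>N. \<forall>z\<in>X \<inter> C y N. \<tau> z 0 = \<tau> y 0" if "y \<in> X" for y
  proof -
    have "continuous_on X (\<lambda>z. \<tau> z 0)"
      using cont by (rule continuous_on_product_then_coordinatewise)
    then have "\<exists>A. open A \<and> A \<inter> X = (\<lambda>z. \<tau> z 0) -` {\<tau> y 0} \<inter> X"
      unfolding continuous_on_open_invariant using open_discrete by blast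
    then obtain A where A: "open A" "A \<inter> X = (\<lambda>z. \<tau> z 0) -` {\<tau> y 0} \<inter> X"
      by blast
    then have "y \<in> A" using \<open>y \<in> X\<close> by auto
    then obtain B where B: "y \<in> Pi\<^sub>E UNIV B" "finite {i. B i \<noteq> UNIV}" "Pi\<^sub>E UNIV B \<subseteq> A"
      using A(1) product_topology_open_contains_basis[of "\<lambda>i :: int. euclidean :: bool topology" UNIV A y]
      by (auto simp: open_fun_def)
    define N where "N = nat (Max (insert 0 (abs ` {i. B i \<noteq> UNIV})))"
    have N: "i \<in> {- int N..int N}" if "B i \<noteq> UNIV" for i
    proof -
      have "\<bar>i\<bar> \<le> Max (insert 0 (abs ` {i. B i \<noteq> UNIV}))"
        using that B(2) by (intro Max_ge) auto
      then show ?thesis unfolding N_def by auto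
    qed
    have "z \<in> A" if "z \<in> C y N" for z
    proof -
      have "z i \<in> B i" for i
      proof (cases "B i = UNIV")
        case False
        then have "z i = y i" using N[of i] that by (auto simp: C_def agree_def)
        then show ?thesis using B(1) by auto
      qed simp
      then show ?thesis using B(3) by auto
    qed
    then show ?thesis using A(2) by (intro exI[of _ N]) auto
  qed
  then obtain N where N: "\<And>y z. y \<in> X \<Longrightarrow> z \<in> X \<inter> C y (N y) \<Longrightarrow> \<tau> z 0 = \<tau> y 0"
    by metis
  have "compact X"
    using compact_Int_closed[OF compact_UNIV_bool_fun \<open>closed X\<close>] by simp
  moreover have "open (C y (N y))" for y
    unfolding C_def by (rule open_cylinder) simp
  moreover have "X \<subseteq> (\<Union>y\<in>X. C y (N y))"
    by (auto simp: C_def agree_def)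
  ultimately obtain D where D: "D \<subseteq> X" "finite D" "X \<subseteq> (\<Union>y\<in>D. C y (N y))"
    by (rule compactE_image)
  define R where "R = Max (insert 0 (N ` D))"
  have "\<tau> y 0 = \<tau> z 0" if "y \<in> X" "z \<in> X" "agree {- int R..int R} y z" for y z
  proof -
    obtain d where d: "d \<in> D" "y \<in> C d (N d)" using D \<open>y \<in> X\<close> by auto
    have "N d \<le> R" using d D(2) unfolding R_def by (intro Max_ge) auto
    then have "z \<in> C d (N d)" using d(2) that(3) by (auto simp: C_def agree_def)
    then show ?thesis using N[of d] d D(1) that by (metis IntI subsetD)
  qed
  then show ?thesis by blast
qed

section \<open>Parses of bi-infinite words\<close>

text \<open>
  A parse describes \<open>x\<close> as a concatenation of disjoint copies of \<open>v\<close> and of ones by the set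
  \<open>E\<close> of the starting positions of the copies. It is a predicate, hence a point of the
  compact space \<open>int \<Rightarrow> bool\<close> itself.
\<close>

definition parse :: "(int \<Rightarrow> bool) \<Rightarrow> bool list \<Rightarrow> (int \<Rightarrow> bool) \<Rightarrow> bool" where
  "parse x v E \<longleftrightarrow>
     (\<forall>e k. E e \<longrightarrow> 0 \<le> k \<longrightarrow> k < int (length v) \<longrightarrow> x (e + k) = v ! nat k) \<and>
     (\<forall>m. \<not> x m \<longrightarrow> (\<exists>e. E e \<and> e \<le> m \<and> m < e + int (length v))) \<and>
     (\<forall>e f. E e \<longrightarrow> E f \<longrightarrow> e < f \<longrightarrow> e + int (length v) \<le> f)"

text \<open>Copies of a base word begin with 0, so none starts inside the run of ones, and in a
  parse \<open>a\<close> is the gap between the copy at \<open>e\<close> and the next one.\<close>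

definition spacer :: "(int \<Rightarrow> bool) \<Rightarrow> bool list \<Rightarrow> (int \<Rightarrow> bool) \<Rightarrow> int \<Rightarrow> int \<Rightarrow> bool" where
  "spacer x v E e a \<longleftrightarrow> 0 \<le> a \<and> E e \<and> E (e + int (length v) + a) \<and>
     (\<forall>m. e + int (length v) \<le> m \<longrightarrow> m < e + int (length v) + a \<longrightarrow> x m)"

lemma length_base_word: "v \<in> base_words \<Longrightarrow> 0 < length v"
  by (auto simp: base_words_def)

lemma parse_at:
  "parse x v E \<Longrightarrow> E e \<Longrightarrow> 0 \<le> k \<Longrightarrow> k < int (length v) \<Longrightarrow> x (e + k) = v ! nat k"
  by (simp add: parse_def)

lemma parse_cover:
  assumes "parse x v E" "\<not> x m"
  obtains e where "E e" "e \<le> m" "m < e + int (length v)"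
  using assms unfolding parse_def by metis

lemma parse_disjoint:
  "parse x v E \<Longrightarrow> E e \<Longrightarrow> E f \<Longrightarrow> e < f \<Longrightarrow> e + int (length v) \<le> f"
  by (simp add: parse_def)

lemma parse_same:
  assumes "parse x v A" "parse y v B" "A e" "B f" "0 \<le> k" "k < int (length v)"
  shows "x (e + k) = y (f + k)"
  using assms by (simp add: parse_at)

lemma parse_first:
  assumes "parse x v E" "v \<in> base_words" "E e"
  shows "\<not> x e"
  using parse_at[OF assms(1,3), of 0] assms(2) length_base_word[OF assms(2)]
  by (auto simp: base_words_def hd_conv_nth)

lemma parse_last:
  assumes "parse x v E" "v \<in> base_words" "E e"
  shows "\<not> x (e + int (length v) - 1)"
proof -
  have "x (e + (int (length v) - 1)) = v ! nat (int (length v) - 1)"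
    using length_base_word[OF assms(2)] by (intro parse_at[OF assms(1,3)]) auto
  moreover have "nat (int (length v) - 1) = length v - 1"
    by auto
  ultimately show ?thesis
    using assms(2) by (auto simp: base_words_def last_conv_nth algebra_simps)
qed

section \<open>Zeros next to runs of ones and the copies they delimit\<close>

lemma first_zero_from:
  fixes x :: "int \<Rightarrow> bool"
  assumes "\<exists>z\<ge>m. \<not> x z"
  obtains z where "m \<le> z" "\<not> x z" "\<And>k. m \<le> k \<Longrightarrow> k < z \<Longrightarrow> x k"
proof -
  define d where "d = (LEAST d. \<not> x (m + int d))"
  have "\<exists>d. \<not> x (m + int d)"
    using assms by (metis zle_iff_zadd)
  then have "\<not> x (m + int d)"
    unfolding d_def by (rule LeastI_ex)
  moreover have "x k" if "m \<le> k" "k < m + int d" for k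
    using that not_less_Least[of "nat (k - m)" "\<lambda>d. \<not> x (m + int d)"] unfolding d_def by auto
  ultimately show ?thesis
    using that[of "m + int d"] by simp
qed

lemma last_zero_before:
  fixes x :: "int \<Rightarrow> bool"
  assumes "z < m" "\<not> x z"
  obtains l where "z \<le> l" "l < m" "\<not> x l" "\<And>k. l < k \<Longrightarrow> k < m \<Longrightarrow> x k"
proof -
  have "\<exists>k\<ge>- m + 1. \<not> x (- k)"
    using assms by (intro exI[of _ "- z"]) auto
  then obtain k where k: "- m + 1 \<le> k" "\<not> x (- k)" "\<And>i. - m + 1 \<le> i \<Longrightarrow> i < k \<Longrightarrow> x (- i)"
    using first_zero_from[of "- m + 1" "\<lambda>k. x (- k)"] by blast
  have "k \<le> - z"
    using k(3)[of "- z"] assms by force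
  moreover have "x i" if "- k < i" "i < m" for i
    using k(3)[of "- i"] that by simp
  ultimately show ?thesis
    using that[of "- k"] k by simp
qed

text \<open>The zero lies in some copy; had that copy started earlier, its initial 0 would be among
  the ones before \<open>z\<close>.\<close>

lemma parse_zero_after_ones:
  assumes x: "parse x v E" and v: "v \<in> base_words"
    and "\<not> x z" and ones: "\<And>k. z - int (length v) < k \<Longrightarrow> k < z \<Longrightarrow> x k"
  shows "E z"
proof -
  obtain e where e: "E e" "e \<le> z" "z < e + int (length v)"
    using parse_cover[OF x \<open>\<not> x z\<close>] .
  have "e < z \<Longrightarrow> x e"
    using e(3) by (intro ones) auto
  then have "e = z"
    using e(2) parse_first[OF x v e(1)] by force
  then show ?thesis using e(1) by simp
qed

text \<open>The copy containing \<open>l\<close> ends before \<open>e\<close> by disjointness. It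
  ends with 0, so its last letter is at \<open>l\<close>.\<close>

lemma parse_before:
  assumes x: "parse x v E" and v: "v \<in> base_words"
    and "E e" "l < e" "\<not> x l" and ones: "\<And>k. l < k \<Longrightarrow> k < e \<Longrightarrow> x k"
  shows "E (l - int (length v) + 1)"
proof -
  obtain c where c: "E c" "c \<le> l" "l < c + int (length v)"
    using parse_cover[OF x \<open>\<not> x l\<close>] .
  have "c + int (length v) \<le> e"
    using parse_disjoint[OF x c(1) \<open>E e\<close>] c \<open>l < e\<close> by simp
  then have "c + int (length v) - 1 = l"
    using parse_last[OF x v c(1)] ones[of "c + int (length v) - 1"] c by force
  then have "c = l - int (length v) + 1" by linarith
  then show ?thesis using c(1) by simp
qed

lemma next_spacer:
  assumes x: "parse x v E" and v: "v \<in> base_words" and "E e"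
    and zero: "\<exists>z\<ge>e + int (length v). \<not> x z"
  shows "\<exists>a. spacer x v E e a"
proof -
  obtain z where z: "e + int (length v) \<le> z" "\<not> x z"
      "\<And>k. e + int (length v) \<le> k \<Longrightarrow> k < z \<Longrightarrow> x k"
    using first_zero_from[OF zero] by blast
  obtain f where f: "E f" "f \<le> z" "z < f + int (length v)"
    using parse_cover[OF x z(2)] .
  have "e < f"
    using f z(1) by auto
  then have "e + int (length v) \<le> f"
    using parse_disjoint[OF x \<open>E e\<close> f(1)] by simp
  then have "f = z"
    using parse_first[OF x v f(1)] z(3)[of f] f(2) by force
  then have "spacer x v E e (z - e - int (length v))"
    using z f \<open>E e\<close> by (auto simp: spacer_def)
  then show ?thesis ..
qed

text \<open>
  Two overlapping, unaligned parses by the same word: the last letter of a copy of one parse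
  lies in a copy of the other one, so neither spacer can be longer than the other.
\<close>

lemma overlap_step:
  assumes x: "parse x v A" and y: "parse y v B" and v: "v \<in> base_words"
    and eq: "\<And>m. M \<le> m \<Longrightarrow> x m = y m"
    and pq: "M \<le> p" "p < q" "q < p + int (length v)"
    and a: "spacer x v A p a" and b: "spacer y v B q b"
  shows "a = b \<and> q < p + int (length v) + a \<and> p + int (length v) + a < q + int (length v)"
proof -
  define n where "n = int (length v)"
  define p' where "p' = p + n + a"
  define q' where "q' = q + n + b"
  have A: "A p" "A p'" "0 \<le> a" "\<And>m. p + n \<le> m \<Longrightarrow> m < p' \<Longrightarrow> x m"
    using a by (auto simp: spacer_def p'_def n_def)
  have B: "B q" "B q'" "0 \<le> b" "\<And>m. q + n \<le> m \<Longrightarrow> m < q' \<Longrightarrow> y m"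
    using b by (auto simp: spacer_def q'_def n_def)
  \<comment> \<open>The final 0 of the copy at \<open>q\<close> cannot lie in the spacer of
    \<open>x\<close>, so the next copy of \<open>x\<close> starts before that copy ends.\<close>
  have "\<not> y (q + n - 1)"
    using parse_last[OF y v B(1)] by (simp add: n_def)
  then have p'_less: "p' \<le> q + n - 1"
    using A(4)[of "q + n - 1"] eq[of "q + n - 1"] pq by (force simp: n_def)
  have last: "\<not> x (p' + n - 1)"
    using parse_last[OF x v A(2)] by (simp add: n_def)
  have "q < p'"
    using A(3) pq by (simp add: p'_def n_def)
  then have q'_less: "q' \<le> p' + n - 1"
    using last B(4)[of "p' + n - 1"] eq[of "p' + n - 1"] pq by (force simp: n_def)
  have "a \<le> b"
  proof (rule ccontr)
    assume "\<not> a \<le> b"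
    \<comment> \<open>The final 0 of the copy at \<open>p'\<close> has offset \<open>k\<close> in
      the copy at \<open>q'\<close>. The same offset in the copy at \<open>q\<close> is position
      \<open>p' - b - 1\<close>, inside the spacer of \<open>x\<close> if
      \<open>b < a\<close>.\<close>
    define k where "k = p' + n - 1 - q'"
    have k: "0 \<le> k" "k < n" "q + k = p' - b - 1" "q' + k = p' + n - 1"
      using p'_less q'_less B(3) by (auto simp: k_def q'_def)
    have "y (q + k) = y (q' + k)"
      by (rule parse_same[OF y y B(1,2) k(1) k(2)[unfolded n_def]])
    then have "\<not> x (p' - b - 1)"
      using last eq[of "p' - b - 1"] eq[of "p' + n - 1"] pq k \<open>q < p'\<close> by auto
    moreover have "x (p' - b - 1)"
      using \<open>\<not> a \<le> b\<close> B(3) by (intro A(4)) (auto simp: p'_def)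
    ultimately show False by simp
  qed
  moreover have "b \<le> a"
  proof (rule ccontr)
    assume "\<not> b \<le> a"
    \<comment> \<open>The 0 at \<open>q\<close> has offset \<open>q - p\<close> in the copy at
      \<open>p\<close>; in the copy at \<open>p'\<close> it recurs at \<open>q + n + a\<close>,
      inside the spacer of \<open>y\<close> if \<open>a < b\<close>.\<close>
    have "x (p + (q - p)) = x (p' + (q - p))"
      using pq by (intro parse_same[OF x x A(1,2)]) auto
    then have "\<not> y (q + n + a)"
      using parse_first[OF y v B(1)] eq[of q] eq[of "q + n + a"] pq A(3)
      by (simp add: p'_def n_def algebra_simps)
    moreover have "y (q + n + a)"
      using \<open>\<not> b \<le> a\<close> A(3) by (intro B(4)) (auto simp: q'_def)
    ultimately show False by simp
  qed
  ultimately show ?thesis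
    using \<open>q < p'\<close> p'_less by (simp add: p'_def n_def)
qed

text \<open>The comparison in \<open>overlap_step\<close> alternates between the parses: the copies
  at \<open>p\<close> and \<open>q\<close> are followed by equal spacers, and the next copy of
  \<open>x\<close> again overlaps the copy at \<open>q\<close>. Thus one length propagates to the
  right forever.\<close>

lemma overlap_constant_spacers:
  assumes x: "parse x v A" and y: "parse y v B" and v: "v \<in> base_words"
    and eq: "\<And>m. M \<le> m \<Longrightarrow> x m = y m"
    and zeros: "\<And>m. \<exists>z\<ge>m. \<not> x z"
    and pq: "M \<le> p" "p < q" "q < p + int (length v)" "A p" "B q"
  shows "\<exists>a. \<forall>k :: nat. spacer x v A (p + int k * (int (length v) + a)) a"
proof -
  define n where "n = int (length v)"
  have "\<exists>z\<ge>m. \<not> y z" for m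
    using zeros[of "max m M"] eq by (metis max.bounded_iff)
  then have next_B: "\<exists>b. spacer y v B e b" if "B e" for e
    using next_spacer[OF y v that] by blast
  have next_A: "\<exists>a. spacer x v A e a" if "A e" for e
    using next_spacer[OF x v that] zeros by blast
  obtain a where a: "spacer x v A p a"
    using next_A pq(4) by blast
  have "spacer x v A (p + int k * (n + a)) a \<and> spacer y v B (q + int k * (n + a)) a" for k
  proof (induction k)
    case 0
    obtain b where "spacer y v B q b"
      using next_B pq(5) by blast
    then show ?case
      using a overlap_step[OF x y v eq pq(1-3) a] by auto
  next
    case (Suc k)
    define p' where "p' = p + int (Suc k) * (n + a)"
    define q' where "q' = q + int (Suc k) * (n + a)"
    define q0 where "q0 = q + int k * (n + a)"
    define p0 where "p0 = p + int k * (n + a)"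
    have "0 \<le> int k * (n + a)"
      using a by (auto simp: spacer_def n_def)
    then have "M \<le> p0" "p0 < q0" "q0 < p0 + n"
      using pq unfolding p0_def q0_def n_def by linarith+
    then have s: "spacer x v A p0 a" "spacer y v B q0 a" "M \<le> p0" "p0 < q0" "q0 < p0 + n"
      and p': "p' = p0 + n + a" and q': "q' = q0 + n + a"
      using Suc by (auto simp: p'_def q'_def p0_def q0_def algebra_simps)
    then have "A p'" "B q'"
      by (auto simp: spacer_def n_def)
    then obtain a' b' where a': "spacer x v A p' a'" and b': "spacer y v B q' b'"
      using next_A next_B by blast
    \<comment> \<open>The next start of \<open>x\<close> lies inside the copy at \<open>q0\<close>,
      so \<open>overlap_step\<close> applies with the roles of \<open>x\<close> and \<open>y\<close>
      exchanged.\<close>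
    have between: "q0 < p'" "p' < q0 + n"
      using overlap_step[OF x y v eq s(3,4) _ s(1,2)] s(5) by (auto simp: p' n_def)
    have "a = a'"
      using overlap_step[OF y x v eq[symmetric] _ between(1) _ s(2) a'] between s by (simp add: n_def)
    moreover have "a' = b'"
      using overlap_step[OF x y v eq _ _ _ a' b'] s p' q' a by (simp add: n_def spacer_def)
    ultimately show ?case
      using a' b' by (simp add: p'_def q'_def)
  qed
  then show ?thesis by (auto simp: n_def)
qed

lemma constant_spacers_periodic:
  assumes x: "parse x v E" and v: "v \<in> base_words"
    and s: "\<And>k :: nat. spacer x v E (p + int k * (int (length v) + a)) a"
    and "p \<le> m"
  shows "x (m + (int (length v) + a)) = x m"
proof -
  define n where "n = int (length v)"
  define P where "P = n + a"
  define k where "k = nat ((m - p) div P)"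
  define e where "e = p + int k * P"
  have "0 < P"
    using s[of 0] length_base_word[OF v] unfolding P_def n_def spacer_def by linarith
  then have "int k = (m - p) div P"
    using \<open>p \<le> m\<close> by (simp add: k_def pos_imp_zdiv_nonneg_iff)
  then have m: "m = e + (m - p) mod P"
    by (simp add: e_def algebra_simps)
  define r where "r = (m - p) mod P"
  have r: "m = e + r" "0 \<le> r" "r < P"
    using m \<open>0 < P\<close> by (auto simp: r_def)
  have s1: "spacer x v E e a"
    using s[of k] by (simp add: e_def P_def n_def)
  have s2: "spacer x v E (e + P) a"
    using s[of "Suc k"] by (simp add: e_def P_def n_def algebra_simps)
  show ?thesis
  proof (cases "r < n")
    case True
    then have "x (e + r) = x (e + P + r)"
      using s1 s2 r by (intro parse_same[OF x x]) (auto simp: spacer_def n_def)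
    then show ?thesis
      by (simp add: r(1) P_def n_def algebra_simps)
  next
    case False
    then have "x (e + r)" "x (e + P + r)"
      using s1 s2 r by (auto simp: spacer_def n_def P_def)
    then show ?thesis
      by (simp add: r(1) P_def n_def algebra_simps)
  qed
qed

text \<open>
  Walking left from a common starting position, the two parses stay equal until the words
  differ, which can only happen inside a spacer.
\<close>

lemma aligned_first_zero:
  assumes x: "parse x v A" and y: "parse y v B" and v: "v \<in> base_words"
    and eq: "\<And>m. M \<le> m \<Longrightarrow> x m = y m" and neq: "x (M - 1) \<noteq> y (M - 1)"
    and z: "M \<le> z" "\<not> x z" "\<And>k. M \<le> k \<Longrightarrow> k < z \<Longrightarrow> x k"
    and e: "M \<le> e" "A e" "B e"
  shows "A z"
proof -
  \<comment> \<open>Induction on the distance of a common start from \<open>M\<close>: if it is not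
    \<open>z\<close>, both parses have a common earlier start.\<close>
  have "A (M + int k) \<Longrightarrow> B (M + int k) \<Longrightarrow> A z" for k
  proof (induction k rule: less_induct)
    case (less k)
    define e where "e = M + int k"
    have e: "A e" "B e" "M \<le> e"
      using less.prems by (simp_all add: e_def)
    have "\<not> x e"
      using parse_first[OF x v e(1)] .
    then have "z \<le> e"
      using z(3)[of e] e(3) by force
    show ?case
    proof (cases "z = e")
      case False
      then obtain l where l: "z \<le> l" "l < e" "\<not> x l" "\<And>k. l < k \<Longrightarrow> k < e \<Longrightarrow> x k"
        using \<open>z \<le> e\<close> last_zero_before[of z e x] z(2) by auto
      define c where "c = l - int (length v) + 1"
      have "A c"
        unfolding c_def using parse_before[OF x v e(1) l(2,3,4)] .
      moreover have "B c"
        unfolding c_def using eq l z(1) by (intro parse_before[OF y v e(2) l(2)]) auto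
      \<comment> \<open>Otherwise both copies would cover \<open>M - 1\<close> at the same offset,
        and the words would agree there.\<close>
      moreover have "M \<le> c"
      proof (rule ccontr)
        assume "\<not> M \<le> c"
        then have "x (c + (M - 1 - c)) = y (c + (M - 1 - c))"
          using l(1) z(1) by (intro parse_same[OF x y \<open>A c\<close> \<open>B c\<close>]) (auto simp: c_def)
        then show False using neq by simp
      qed
      moreover have "nat (c - M) < k"
        using l(2) length_base_word[OF v] \<open>M \<le> c\<close> unfolding c_def e_def by linarith
      ultimately show ?thesis
        using less.IH[of "nat (c - M)"] by simp
    qed (use e in simp)
  qed
  from this[of "nat (e - M)"] show ?thesis using e by simp
qed

section \<open>Rank-1 systems\<close>

text \<open>Padding with ones is harmless for parses, since parses only see the zeros.\<close>

definition extend :: "bool word \<Rightarrow> int \<Rightarrow> bool" where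
  "extend V m \<longleftrightarrow> (0 \<le> m \<longrightarrow> V (nat m))"

text \<open>The copies start at the lengths \<open>pos n\<close> of the initial parts, which are
  unbounded, so every position of \<open>V\<close> is reached.\<close>

lemma built_from_parse:
  assumes "built_from V v"
  shows "\<exists>E. parse (extend V) v E \<and> E 0 \<and> (\<forall>m. \<exists>e\<ge>m. E e)"
proof -
  obtain a where v: "v \<in> base_words" and a: "\<And>n. \<exists>W.
      V = concat (map (\<lambda>i. v @ replicate (a i) True) [1..<Suc n]) \<frown> W"
    using assms unfolding built_from_def by blast
  define c where "c n = concat (map (\<lambda>i. v @ replicate (a i) True) [1..<Suc n])" for n :: nat
  define pos where "pos n = length (c n)" for n
  have c_Suc: "c (Suc n) = c n @ v @ replicate (a (Suc n)) True" for n
    by (simp add: c_def)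
  have c_0: "c 0 = []"
    by (simp add: c_def)
  have V: "V k = c n ! k" if "k < pos n" for n k
    using a[of n] that unfolding c_def[symmetric] pos_def by (metis conc_fst)
  have pos_Suc: "pos (Suc n) = pos n + length v + a (Suc n)" for n
    by (simp add: pos_def c_Suc)
  have "strict_mono pos"
    using length_base_word[OF v] by (simp add: strict_mono_Suc_iff pos_Suc)
  have copy: "V (pos n + k) = v ! k" if "k < length v" for n k
    using that V[of "pos n + k" "Suc n"] by (simp add: pos_Suc c_Suc nth_append flip: pos_def)
  have cover: "\<exists>j. pos j \<le> k \<and> k < pos j + length v" if "k < pos n" "\<not> V k" for n k
    using that(1)
  proof (induction n)
    case 0
    then show ?case by (simp add: pos_def c_0)
  next
    case (Suc n)
    have "V k" if "pos n + length v \<le> k"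
    proof -
      have "\<not> k < pos n" "\<not> k - pos n < length v"
        using that by linarith+
      then have "V k = replicate (a (Suc n)) True ! (k - pos n - length v)"
        using V[OF Suc.prems] by (simp add: c_Suc nth_append flip: pos_def)
      then show ?thesis
        using Suc.prems that by (simp add: pos_Suc)
    qed
    then show ?case
      using Suc \<open>\<not> V k\<close> by (metis not_le)
  qed
  have disjoint: "pos i + length v \<le> pos j" if "pos i < pos j" for i j
  proof -
    have "Suc i \<le> j"
      using that \<open>strict_mono pos\<close> by (simp add: strict_mono_less)
    then have "pos (Suc i) \<le> pos j"
      using \<open>strict_mono pos\<close> by (simp add: strict_mono_less_eq)
    then show ?thesis by (simp add: pos_Suc)
  qed
  have unbounded: "n \<le> pos n" for n
    using \<open>strict_mono pos\<close> by (rule strict_mono_imp_increasing)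
  define E where "E e \<longleftrightarrow> (\<exists>n. e = int (pos n))" for e
  have "parse (extend V) v E"
    unfolding parse_def
  proof (intro conjI allI impI)
    fix e k assume "E e" "0 \<le> k" "k < int (length v)"
    then show "extend V (e + k) = v ! nat k"
      using copy by (auto simp: E_def extend_def nat_add_distrib)
  next
    fix m assume "\<not> extend V m"
    then have "0 \<le> m" "\<not> V (nat m)" by (auto simp: extend_def)
    then obtain j where "pos j \<le> nat m" "nat m < pos j + length v"
      using cover[of "nat m" "Suc (nat m)"] unbounded[of "Suc (nat m)"] by auto
    then show "\<exists>e. E e \<and> e \<le> m \<and> m < e + int (length v)"
      using \<open>0 \<le> m\<close> by (intro exI[of _ "int (pos j)"]) (auto simp: E_def)
  next
    fix e f assume "E e" "E f" "e < f"
    then show "e + int (length v) \<le> f"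
      using disjoint by (force simp: E_def)
  qed
  moreover have "E 0"
    by (auto simp: E_def pos_def c_0 intro: exI[of _ 0])
  moreover have "\<exists>e\<ge>m. E e" for m
    using unbounded[of "nat m"] by (intro exI[of _ "int (pos (nat m))"]) (auto simp: E_def)
  ultimately show ?thesis by blast
qed

lemma built_from_prefix:
  assumes "built_from V v" "k < length v"
  shows "v ! k = V k"
proof -
  obtain E where E: "parse (extend V) v E" "E 0"
    using built_from_parse[OF assms(1)] by blast
  have "extend V (0 + int k) = v ! nat (int k)"
    using assms(2) by (intro parse_at[OF E]) auto
  then show ?thesis by (simp add: extend_def)
qed

text \<open>Every finite window lies in one centred at the origin. The bound
  \<open>i \<ge> int N\<close> keeps the window of \<open>extend V\<close> away from the
  padding.\<close>

lemma mem_rank1_system_iff: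
  "x \<in> rank1_system V \<longleftrightarrow>
    (\<forall>N :: nat. \<exists>i\<ge>int N. agree {- int N..int N} x (\<lambda>m. extend V (m + i)))" (is "?L \<longleftrightarrow> ?R")
proof
  assume ?L
  show ?R
  proof
    fix N :: nat
    have "map x [- int N..int N] \<in> subwords V"
      using \<open>?L\<close> by (auto simp: rank1_system_def bi_subwords_def)
    then obtain i j where ij: "map x [- int N..int N] = V [i \<rightarrow> j]"
      by (auto simp: subwords_def)
    then have "length (map x [- int N..int N]) = j - i"
      by simp
    then have len: "j - i = 2 * N + 1" by simp
    have "x m = extend V (m + int (i + N))" if "m \<in> {- int N..int N}" for m
    proof -
      define k where "k = nat (m + int N)"
      have "x m = map x [- int N..int N] ! k"
        using that by (simp add: k_def)
      also have "\<dots> = V (i + k)"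
        using that len unfolding ij by (subst subsequence_nth) (auto simp: k_def)
      also have "i + k = nat (m + int (i + N))"
        using that unfolding k_def atLeastAtMost_iff by linarith
      finally show ?thesis
        using that by (simp add: extend_def)
    qed
    then show "\<exists>i\<ge>int N. agree {- int N..int N} x (\<lambda>m. extend V (m + i))"
      by (intro exI[of _ "int (i + N)"]) (auto simp: agree_def)
  qed
next
  assume R: ?R
  have "map x [i..j] \<in> subwords V" for i j
  proof -
    define N where "N = nat (max \<bar>i\<bar> \<bar>j\<bar>)"
    obtain s where s: "int N \<le> s" "agree {- int N..int N} x (\<lambda>m. extend V (m + s))"
      using R by blast
    have N: "- int N \<le> i" "j \<le> int N"
      by (auto simp: N_def)
    have "map x [i..j] = V [nat (i + s) \<rightarrow> nat (j + s + 1)]"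
    proof (rule nth_equalityI)
      show "length (map x [i..j]) = length (V [nat (i + s) \<rightarrow> nat (j + s + 1)])"
        using N s(1) by (simp add: nat_diff_distrib')
    next
      fix k assume "k < length (map x [i..j])"
      then have k: "i + int k \<le> j" by auto
      then have "x (i + int k) = extend V (i + int k + s)"
        using s(2) N by (auto simp: agree_def)
      also have "\<dots> = V (nat (i + s) + k)"
      proof -
        have "nat (i + int k + s) = nat (i + s) + k" "0 \<le> i + int k + s"
          using N s(1) by auto
        then show ?thesis by (simp add: extend_def)
      qed
      also have "\<dots> = V [nat (i + s) \<rightarrow> nat (j + s + 1)] ! k"
        using k N s(1) by (subst subsequence_nth) auto
      finally show "map x [i..j] ! k = V [nat (i + s) \<rightarrow> nat (j + s + 1)] ! k"
        using k by simp
    qed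
    then show ?thesis
      unfolding subwords_def by blast
  qed
  then show ?L
    by (auto simp: rank1_system_def bi_subwords_def)
qed

lemma closed_rank1_system: "closed (rank1_system V)"
proof -
  have "rank1_system V = (\<Inter>N :: nat. {x. \<exists>i\<ge>int N. agree {- int N..int N} x (\<lambda>m. extend V (m + i))})"
    using mem_rank1_system_iff by auto
  moreover have "closed {x. \<exists>i\<ge>int N. agree {- int N..int N} x (\<lambda>m. extend V (m + i))}" for N
  proof (rule closed_finitely_determined)
    show "finite {- int N..int N}" by simp
  qed (auto simp: agree_def)
  ultimately show ?thesis
    by (simp only:) (intro closed_INT ballI)
qed

lemma rank1_system_shift:
  assumes "x \<in> rank1_system V"
  shows "(\<lambda>m. x (m + k)) \<in> rank1_system V"
  using int_iterate_shift_in_system[OF assms, of k] by (simp add: int_iterate_shift)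

text \<open>By compactness: \<open>K N\<close> imposes the parse conditions on the window of radius
  \<open>N\<close> only. Translates of a parse of \<open>extend V\<close> make it nonempty, and a
  point common to all \<open>K N\<close> is a parse.\<close>

lemma rank1_system_parse:
  assumes x: "x \<in> rank1_system V" and v: "built_from V v"
  shows "\<exists>E. parse x v E"
proof -
  define n where "n = int (length v)"
  obtain E0 where E0: "parse (extend V) v E0"
    using built_from_parse[OF v] by blast
  define K where "K N = {E.
     (\<forall>e\<in>{- int N..int N}. \<forall>k. E e \<longrightarrow> 0 \<le> k \<longrightarrow> k < n \<longrightarrow> x (e + k) = v ! nat k) \<and>
     (\<forall>m\<in>{- int N..int N}. \<not> x m \<longrightarrow> (\<exists>e. E e \<and> e \<le> m \<and> m < e + n)) \<and>
     (\<forall>e\<in>{- int N..int N}. \<forall>f\<in>{- int N..int N}. E e \<longrightarrow> E f \<longrightarrow> e < f \<longrightarrow> e + n \<le> f)}" for N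
  have "\<exists>E. \<forall>N. E \<in> K N"
  proof (rule nested_closed_INT_nonempty)
    show "closed (K N)" for N
    proof (rule closed_finitely_determined)
      \<comment> \<open>The extra \<open>n\<close> coordinates are there because a copy covering a
        letter of the window may start to the left of it.\<close>
      show "finite {- int N - n..int N}" by simp
      show "E' \<in> K N" if "agree {- int N - n..int N} E E'" "E \<in> K N" for E E'
      proof -
        have eq: "E e = E' e" if "- int N - n \<le> e" "e \<le> int N" for e
          using \<open>agree _ _ _\<close> that by (simp add: agree_def)
        have "0 \<le> n" by (simp add: n_def)
        have "\<exists>e. E' e \<and> e \<le> m \<and> m < e + n" if m: "m \<in> {- int N..int N}" "\<not> x m" for m
        proof -
          obtain e where "E e" "e \<le> m" "m < e + n"
            using \<open>E \<in> K N\<close> m unfolding K_def by blast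
          then show ?thesis
            using eq[of e] m by auto
        qed
        then show ?thesis
          using \<open>E \<in> K N\<close> eq \<open>0 \<le> n\<close> by (simp add: K_def)
      qed
    qed
    show "K N \<noteq> {}" for N
    proof -
      define L where "L = nat (int N + n)"
      obtain i where i: "agree {- int L..int L} x (\<lambda>m. extend V (m + i))"
        using x mem_rank1_system_iff by blast
      then have xV: "x m = extend V (m + i)" if "- int N - n \<le> m" "m \<le> int N + n" for m
        using that by (simp add: agree_def L_def n_def)
      have "(\<lambda>e. E0 (e + i)) \<in> K N"
        unfolding K_def mem_Collect_eq
      proof (intro conjI ballI allI impI)
        fix e k assume "e \<in> {- int N..int N}" "E0 (e + i)" "0 \<le> k" "k < n"
        then show "x (e + k) = v ! nat k"
          using parse_at[OF E0, of "e + i" k] xV[of "e + k"] by (simp add: n_def algebra_simps)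
      next
        fix m assume "m \<in> {- int N..int N}" "\<not> x m"
        then have "\<not> extend V (m + i)"
          using xV[of m] by (simp add: n_def)
        then obtain e where "E0 e" "e \<le> m + i" "m + i < e + n"
          using parse_cover[OF E0] n_def by metis
        then show "\<exists>e. E0 (e + i) \<and> e \<le> m \<and> m < e + n"
          by (intro exI[of _ "e - i"]) auto
      next
        fix e f assume "E0 (e + i)" "E0 (f + i)" "e < f"
        then show "e + n \<le> f"
          using parse_disjoint[OF E0, of "e + i" "f + i"] by (simp add: n_def)
      qed
      then show ?thesis by blast
    qed
    show "K (Suc N) \<subseteq> K N" for N
      by (rule subsetI) (simp add: K_def)
  qed
  then obtain E where E: "\<And>N. E \<in> K N" by blast
  have "parse x v E"
    unfolding parse_def
  proof (intro conjI allI impI)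
    fix e k assume ek: "E e" "0 \<le> k" "k < int (length v)"
    have "e \<in> {- int (nat \<bar>e\<bar>)..int (nat \<bar>e\<bar>)}" by auto
    then show "x (e + k) = v ! nat k"
      using E[of "nat \<bar>e\<bar>"] ek unfolding K_def n_def by blast
  next
    fix m assume m: "\<not> x m"
    have "m \<in> {- int (nat \<bar>m\<bar>)..int (nat \<bar>m\<bar>)}" by auto
    then show "\<exists>e. E e \<and> e \<le> m \<and> m < e + int (length v)"
      using E[of "nat \<bar>m\<bar>"] m unfolding K_def n_def by blast
  next
    fix e f assume ef: "E e" "E f" "e < f"
    define N where "N = nat (max \<bar>e\<bar> \<bar>f\<bar>)"
    have "e \<in> {- int N..int N}" "f \<in> {- int N..int N}"
      by (auto simp: N_def)
    then show "e + int (length v) \<le> f"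
      using E[of N] ef unfolding K_def n_def by blast
  qed
  then show ?thesis by blast
qed

definition tail_at :: "bool word \<Rightarrow> (int \<Rightarrow> bool) \<Rightarrow> int \<Rightarrow> bool" where
  "tail_at V x c \<longleftrightarrow> (\<forall>m\<ge>0. x (m + c) = extend V m)"

section \<open>Aperiodicity and points with tail \<open>V\<close>\<close>

locale nondegenerate_rank1 =
  fixes V :: "bool word"
  assumes rank1: "rank1_word V" and nondegenerate: "\<not> degenerate V"
begin

abbreviation X :: "(int \<Rightarrow> bool) set" where "X \<equiv> rank1_system V"

text \<open>The words from which \<open>V\<close> is built are prefixes of \<open>V\<close>, hence
  determined by their lengths; infinitely many of them have unbounded length.\<close>

lemma long_base:
  obtains u where "built_from V u" "u \<in> base_words" "n < length u"
proof -
  have "\<exists>u. built_from V u \<and> n < length u"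
  proof (rule ccontr)
    assume "\<not> ?thesis"
    then have "{u. built_from V u} \<subseteq> (\<lambda>l. map V [0..<l]) ` {..n}"
      by (auto simp: not_less built_from_prefix intro!: image_eqI[of _ _ "length _"] nth_equalityI)
    then have "finite {u. built_from V u}"
      by (rule finite_subset) simp
    then show False
      using rank1 by (simp add: rank1_word_def)
  qed
  then show ?thesis
    using that by (auto simp: built_from_def)
qed

text \<open>Otherwise \<open>V\<close> would be the infinite power of its prefix of length
  \<open>P\<close>.\<close>

lemma not_periodic:
  assumes "0 < P"
  obtains k where "V (k + P) \<noteq> V k"
proof -
  have "\<exists>k. V (k + P) \<noteq> V k"
  proof (rule ccontr)
    assume "\<not> ?thesis"
    then have step: "V (k + P) = V k" for k by blast
    have mult: "V (k + j * P) = V k" for j k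
      by (induction j) (use step[of "k + _ * P"] in \<open>simp_all add: algebra_simps\<close>)
    have "V n = V (n mod P)" for n
      using mult[of "n mod P" "n div P"] by simp
    then have "V = (map V [0..<P])\<^sup>\<omega>"
      using assms by (intro ext) simp
    then show False
      using assms nondegenerate unfolding degenerate_def by (metis length_map length_upt diff_zero list.size(3) less_irrefl)
  qed
  then show ?thesis using that by blast
qed

lemma copy_around_zero:
  assumes "x \<in> X" "built_from V u" "\<not> x m"
  obtains e where "e \<le> m" "m < e + int (length u)" "\<And>k. k < length u \<Longrightarrow> x (e + int k) = V k"
proof -
  obtain E where E: "parse x u E"
    using rank1_system_parse[OF assms(1,2)] by blast
  obtain e where "E e" "e \<le> m" "m < e + int (length u)"
    using parse_cover[OF E assms(3)] .
  moreover have "x (e + int k) = V k" if "k < length u" for k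
    using parse_at[OF E \<open>E e\<close>, of "int k"] that built_from_prefix[OF assms(2)] by simp
  ultimately show ?thesis using that by blast
qed

text \<open>A zero far to the right lies in a copy of a long prefix of \<open>V\<close>, whose
  period \<open>P\<close> would contradict \<open>not_periodic\<close>.\<close>

lemma not_eventually_periodic:
  assumes "x \<in> X" and zeros: "\<And>m. \<exists>z\<ge>m. \<not> x z" and "0 < P"
    and periodic: "\<And>m. p \<le> m \<Longrightarrow> x (m + P) = x m"
  shows False
proof -
  obtain k where k: "V (k + nat P) \<noteq> V k"
    using not_periodic[of "nat P"] \<open>0 < P\<close> by auto
  obtain u where u: "built_from V u" "k + nat P < length u"
    using long_base by blast
  \<comment> \<open>This distance from \<open>p\<close> puts the whole copy around \<open>z\<close>
    to the right of \<open>p\<close>.\<close>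
  obtain z where z: "p + int (length u) \<le> z" "\<not> x z"
    using zeros by blast
  obtain e where "e \<le> z" and e: "z < e + int (length u)" "\<And>k. k < length u \<Longrightarrow> x (e + int k) = V k"
    using copy_around_zero[OF assms(1) u(1) z(2)] by blast
  have "x (e + int k + P) = x (e + int k)"
    using e(1) z(1) by (intro periodic) auto
  moreover have "x (e + int (k + nat P)) = V (k + nat P)" "x (e + int k) = V k"
    using u(2) e(2)[of "k + nat P"] e(2)[of k] by simp_all
  ultimately show False
    using k \<open>0 < P\<close> by (simp add: algebra_simps)
qed

lemma no_constant_spacers:
  assumes "x \<in> X" "\<And>m. \<exists>z\<ge>m. \<not> x z" "parse x v E" "v \<in> base_words"
    and s: "\<And>k :: nat. spacer x v E (p + int k * (int (length v) + a)) a"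
  shows False
proof (rule not_eventually_periodic[OF assms(1,2)])
  show "0 < int (length v) + a"
    using s[of 0] length_base_word[OF assms(4)] unfolding spacer_def by linarith
  show "x (m + (int (length v) + a)) = x m" if "p \<le> m" for m
    using constant_spacers_periodic[OF assms(3-5) that] .
qed

lemma zero_not_mem: "(\<lambda>_. False) \<notin> X"
proof
  assume X: "(\<lambda>_. False) \<in> X"
  have "\<not> V k" for k
  proof -
    obtain u where u: "built_from V u" "k < length u"
      using long_base by blast
    show ?thesis
      by (rule copy_around_zero[OF X u(1)]) (use u(2) in auto)
  qed
  then show False
    using not_periodic[of 1] by auto
qed

lemma tail_atI:
  assumes "\<And>u k. built_from V u \<Longrightarrow> u \<in> base_words \<Longrightarrow> k < length u \<Longrightarrow> x (c + int k) = V k"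
  shows "tail_at V x c"
  unfolding tail_at_def
proof (intro allI impI)
  fix m :: int assume "0 \<le> m"
  obtain u where "built_from V u" "u \<in> base_words" "nat m < length u"
    using long_base by blast
  then show "x (m + c) = extend V m"
    using assms[of u "nat m"] \<open>0 \<le> m\<close> by (simp add: extend_def algebra_simps)
qed

text \<open>The copies at \<open>c\<close> are prefixes of \<open>V\<close> of unbounded
  length.\<close>

lemma tail_at_parse:
  assumes "\<And>u. built_from V u \<Longrightarrow> u \<in> base_words \<Longrightarrow> \<exists>E. parse x u E \<and> E c"
  shows "tail_at V x c"
proof (rule tail_atI)
  fix u k assume u: "built_from V u" "u \<in> base_words" "k < length u"
  then obtain E where "parse x u E" "E c"
    using assms by blast
  then show "x (c + int k) = V k"
    using parse_at[of x u E c "int k"] u built_from_prefix by auto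
qed

text \<open>The first zero after an infinite run of ones starts a copy, whichever word
  \<open>u\<close> is used to parse.\<close>

lemma tail_after_ones:
  assumes "x \<in> X" "\<not> x c" "\<And>m. m < c \<Longrightarrow> x m"
  shows "tail_at V x c"
proof (rule tail_at_parse)
  fix u assume u: "built_from V u" "u \<in> base_words"
  obtain E where E: "parse x u E"
    using rank1_system_parse[OF assms(1) u(1)] by blast
  then have "E c"
    by (rule parse_zero_after_ones) (use u assms in auto)
  with E show "\<exists>E. parse x u E \<and> E c" by blast
qed

lemma right_asymptotic_tail:
  assumes x: "x \<in> X" and y: "y \<in> X" and "x \<noteq> y"
    and asymptotic: "\<And>m. M \<le> m \<Longrightarrow> x m = y m"
    and zeros: "\<And>m. \<exists>z\<ge>m. \<not> x z"
  obtains c where "tail_at V x c" "tail_at V y c"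
proof -
  obtain d where d: "x d \<noteq> y d" using \<open>x \<noteq> y\<close> by blast
  then have "d < M" using asymptotic[of d] by force
  \<comment> \<open>Here the predicate is agreement of the two words, so its last zero
    \<open>l\<close> is their last disagreement.\<close>
  then obtain l where l: "x l \<noteq> y l" "\<And>m. l < m \<Longrightarrow> m < M \<Longrightarrow> x m = y m"
    using last_zero_before[of d M "\<lambda>m. x m = y m"] d by metis
  define L where "L = l + 1"
  have eq: "x m = y m" if "L \<le> m" for m
    using l(2)[of m] asymptotic[of m] that by (cases "m < M") (auto simp: L_def)
  have neq: "x (L - 1) \<noteq> y (L - 1)"
    using l(1) by (simp add: L_def)
  obtain c where c: "L \<le> c" "\<not> x c" "\<And>k. L \<le> k \<Longrightarrow> k < c \<Longrightarrow> x k"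
    using first_zero_from[OF zeros[of L]] by blast
  have zeros_y: "\<exists>z\<ge>m. \<not> y z" for m
    using zeros[of "max m L"] eq by (metis max.bounded_iff)
  have "\<exists>A. parse x u A \<and> A c" if u: "built_from V u" "u \<in> base_words" for u
  proof -
    obtain A B where A: "parse x u A" and B: "parse y u B"
      using rank1_system_parse x y u(1) by metis
    have no_overlap_xy: False if pq: "L \<le> p" "p < q" "q < p + int (length u)" "A p" "B q" for p q
    proof -
      obtain a where "\<And>k :: nat. spacer x u A (p + int k * (int (length u) + a)) a"
        using overlap_constant_spacers[OF A B u(2) eq zeros pq] by blast
      then show False
        using no_constant_spacers[OF x zeros A u(2)] by blast
    qed
    have no_overlap_yx: False if pq: "L \<le> p" "p < q" "q < p + int (length u)" "B p" "A q" for p q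
    proof -
      obtain a where "\<And>k :: nat. spacer y u B (p + int k * (int (length u) + a)) a"
        using overlap_constant_spacers[OF B A u(2) eq[symmetric] zeros_y pq] by blast
      then show False
        using no_constant_spacers[OF y zeros_y B u(2)] by blast
    qed
    \<comment> \<open>Both copies around \<open>z\<close> then start in the common part, where
      distinct starts would be an excluded overlap.\<close>
    obtain z where z: "L + int (length u) \<le> z" "\<not> x z"
      using zeros by blast
    obtain e where e: "A e" "e \<le> z" "z < e + int (length u)"
      using parse_cover[OF A z(2)] .
    obtain f where f: "B f" "f \<le> z" "z < f + int (length u)"
      using parse_cover[OF B, of z] z eq[of z] by auto
    have "e = f"
      using no_overlap_xy[of e f] no_overlap_yx[of f e] e f z(1) by force
    then have "A c"
      using aligned_first_zero[OF A B u(2) eq neq c, of e] e f z(1) by auto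
    with A show ?thesis by blast
  qed
  then have "tail_at V x c"
    by (rule tail_at_parse)
  moreover have "tail_at V y c"
    using \<open>tail_at V x c\<close> eq c(1) by (simp add: tail_at_def)
  ultimately show ?thesis using that by blast
qed

section \<open>Gaps between zeros and right asymptotic pairs\<close>

lemma zeros_syndetic:
  assumes "(\<lambda>_. True) \<notin> X"
  obtains B where "\<And>x m. x \<in> X \<Longrightarrow> \<exists>z. m \<le> z \<and> z \<le> m + B \<and> \<not> x z"
proof -
  \<comment> \<open>\<open>V\<close> has no run of \<open>2 * N + 1\<close> ones, and every word of
    that length in a point of \<open>X\<close> occurs in \<open>V\<close>.\<close>
  obtain N where N: "\<And>i. int N \<le> i \<Longrightarrow> \<not> agree {- int N..int N} (\<lambda>_. True) (\<lambda>m. extend V (m + i))"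
    using assms mem_rank1_system_iff by blast
  have "\<exists>z. m \<le> z \<and> z \<le> m + 2 * int N \<and> \<not> x z" if "x \<in> X" for x m
  proof -
    define L where "L = nat (\<bar>m\<bar> + 2 * int N)"
    obtain i where i: "int L \<le> i" "agree {- int L..int L} x (\<lambda>m. extend V (m + i))"
      using \<open>x \<in> X\<close> mem_rank1_system_iff by blast
    then have "int N \<le> i + m + int N"
      by (auto simp: L_def)
    then have "\<not> agree {- int N..int N} (\<lambda>_. True) (\<lambda>k. extend V (k + (i + m + int N)))"
      by (rule N)
    then obtain k where k: "- int N \<le> k" "k \<le> int N" "\<not> extend V (k + (i + m + int N))"
      by (auto simp: agree_def)
    have "m + int N + k \<in> {- int L..int L}"
      using k unfolding L_def by auto
    then have "x (m + int N + k) = extend V (m + int N + k + i)"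
      using i(2) by (simp add: agree_def)
    then show ?thesis
      using k by (intro exI[of _ "m + int N + k"]) (auto simp: algebra_simps)
  qed
  then show ?thesis using that by blast
qed

text \<open>With only one spacer length, every copy would begin an infinite sequence of constant
  spacers.\<close>

lemma distinct_spacers:
  assumes x: "x \<in> X" and zeros: "\<And>m. \<exists>z\<ge>m. \<not> x z"
    and E: "parse x v E" and v: "v \<in> base_words"
  shows "\<exists>e f a b. spacer x v E e a \<and> spacer x v E f b \<and> a < b"
proof (rule ccontr)
  assume "\<not> ?thesis"
  then have unique: "a = b" if "spacer x v E e a" "spacer x v E f b" for e f a b
    using that by (meson linorder_neqE_linordered_idom)
  have ex: "\<exists>a. spacer x v E e a" if "E e" for e
    using next_spacer[OF E v that] zeros by blast
  obtain p where "E p"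
    using zeros parse_cover[OF E] by metis
  then obtain a where a: "spacer x v E p a"
    using ex by blast
  have "spacer x v E (p + int k * (int (length v) + a)) a" for k
  proof (induction k)
    case (Suc k)
    then have "E (p + int (Suc k) * (int (length v) + a))"
      by (simp add: spacer_def algebra_simps)
    then show ?case
      using ex unique a by blast
  qed (use a in simp)
  then show False
    using no_constant_spacers[OF x zeros E v] by blast
qed

text \<open>A copy after a spacer of length \<open>a\<close> has a 0 at distance
  \<open>a + 1\<close> to its left; a copy after a longer spacer has a 1 there. Such pairs exist for
  arbitrarily long prefixes of \<open>V\<close> with \<open>a\<close> at most \<open>B\<close>;
  pigeonhole fixes \<open>a\<close>, and compactness yields the limits.\<close>

lemma right_asymptotic_pair:
  assumes x: "x \<in> X" and B: "\<And>m. \<exists>z. m \<le> z \<and> z \<le> m + B \<and> \<not> x z"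
  obtains y z where "y \<in> X" "z \<in> X" "y \<noteq> z" "tail_at V y 0" "tail_at V z 0"
proof -
  define K where "K g b n = {y \<in> X. (\<forall>k<n. y (int k) = V k) \<and> y (- 1 - g) = b}"
    for g :: int and b and n :: nat
  have mono: "K g b n \<subseteq> K g b m" if "m \<le> n" for g b m n
    using that by (auto simp: K_def)
  have "\<exists>g\<in>{0..B}. \<forall>b. K g b n \<noteq> {}" for n
  proof -
    obtain u where u: "built_from V u" "u \<in> base_words" "n < length u"
      using long_base by blast
    obtain E where E: "parse x u E"
      using rank1_system_parse[OF x u(1)] by blast
    have "\<exists>z\<ge>m. \<not> x z" for m
      using B by blast
    then obtain e f a b where ef: "spacer x u E e a" "spacer x u E f b" "a < b"
      using distinct_spacers[OF x _ E u(2)] by blast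
    define e' where "e' = e + int (length u) + a"
    define f' where "f' = f + int (length u) + b"
    have e': "E e" "E e'" "E f'" "0 \<le> a"
      using ef by (auto simp: spacer_def e'_def f'_def)
    have prefix: "x (int k + c) = V k" if "E c" "k < n" for c k
      using parse_at[OF E that(1), of "int k"] built_from_prefix[OF u(1), of k] that u(3)
      by (simp add: algebra_simps)
    obtain z where "e + int (length u) \<le> z" "z \<le> e + int (length u) + B" "\<not> x z"
      using B by blast
    then have "a \<le> B"
      using ef(1) by (force simp: spacer_def)
    moreover have "\<not> x (- 1 - a + e')"
      using parse_last[OF E u(2) e'(1)] by (simp add: e'_def algebra_simps)
    then have "(\<lambda>m. x (m + e')) \<in> K a False n"
      using e' prefix rank1_system_shift[OF x] by (simp add: K_def)
    moreover have "x (- 1 - a + f')"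
      using ef e'(4) by (simp add: spacer_def f'_def)
    then have "(\<lambda>m. x (m + f')) \<in> K a True n"
      using e' prefix rank1_system_shift[OF x] by (simp add: K_def)
    ultimately show ?thesis
      using \<open>0 \<le> a\<close> by (metis (full_types) atLeastAtMost_iff empty_iff)
  qed
  have "\<exists>g. \<forall>b n. K g b n \<noteq> {}"
  proof (rule ccontr)
    assume "\<not> ?thesis"
    \<comment> \<open>If each \<open>g\<close> failed at some length \<open>n g\<close>, the largest
      of these over \<open>{0..B}\<close> would defeat all \<open>g\<close> in this range at
      once.\<close>
    then obtain b n where bn: "\<And>g. K g (b g) (n g) = {}" by metis
    obtain g where g: "g \<in> {0..B}" "\<And>b. K g b (Max (n ` {0..B})) \<noteq> {}"
      using \<open>\<And>n. \<exists>g\<in>{0..B}. \<forall>b. K g b n \<noteq> {}\<close> by blast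
    have "n g \<le> Max (n ` {0..B})"
      using g(1) by (intro Max_ge) auto
    then show False
      using mono g(2) bn by blast
  qed
  then obtain g where g: "\<And>b n. K g b n \<noteq> {}" by blast
  have ex: "\<exists>y. \<forall>n. y \<in> K g b n" for b
  proof (rule nested_closed_INT_nonempty)
    show "closed (K g b n)" for n
    proof -
      have "closed {y :: int \<Rightarrow> bool. (\<forall>k<n. y (int k) = V k) \<and> y (- 1 - g) = b}"
        by (rule closed_finitely_determined[of "insert (- 1 - g) (int ` {..<n})"])
          (auto simp: agree_def)
      then have "closed (X \<inter> {y. (\<forall>k<n. y (int k) = V k) \<and> y (- 1 - g) = b})"
        by (intro closed_Int closed_rank1_system)
      then show ?thesis by (simp add: K_def Int_def)
    qed
  qed (use g mono in auto)
  have tail: "tail_at V y 0" if "\<forall>n. y \<in> K g b n" for y b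
  proof (rule tail_atI)
    show "y (0 + int k) = V k" for k
      using that[rule_format, of "Suc k"] by (simp add: K_def)
  qed
  obtain y z where yz: "\<forall>n. y \<in> K g False n" "\<forall>n. z \<in> K g True n"
    using ex by metis
  then have "y (- 1 - g) \<noteq> z (- 1 - g)" "y \<in> X" "z \<in> X"
    by (simp_all add: K_def)
  then show ?thesis
    using that tail yz by metis
qed

text \<open>The first zero after a long run of ones in \<open>V\<close> starts a copy of
  \<open>u\<close>. So ones followed by a prefix of \<open>V\<close>, as seen in
  \<open>extend V\<close> around the origin, occur in \<open>V\<close>.\<close>

lemma extend_mem:
  assumes "(\<lambda>_. True) \<in> X"
  shows "extend V \<in> X"
  unfolding mem_rank1_system_iff
proof
  fix N :: nat
  obtain u where u: "built_from V u" "u \<in> base_words" "N < length u"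
    using long_base by blast
  obtain E where E: "parse (extend V) u E" "\<And>m. \<exists>e\<ge>m. E e"
    using built_from_parse[OF u(1)] by blast
  \<comment> \<open>A run of \<open>length u\<close> ones forces a copy to start at the next zero;
    \<open>N\<close> ones match the padding.\<close>
  define L where "L = N + length u"
  obtain i where i: "int L \<le> i" "agree {- int L..int L} (\<lambda>_. True) (\<lambda>m. extend V (m + i))"
    using assms mem_rank1_system_iff by blast
  have "\<exists>z\<ge>i. \<not> extend V z"
    using E parse_first[OF E(1) u(2)] by blast
  then obtain z where z: "i \<le> z" "\<not> extend V z" "\<And>k. i \<le> k \<Longrightarrow> k < z \<Longrightarrow> extend V k"
    using first_zero_from by blast
  have ones: "extend V k" if "z - int L \<le> k" "k < z" for k
  proof (cases "i \<le> k")
    case False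
    then have "k - i \<in> {- int L..int L}"
      using that z(1) by auto
    then show ?thesis
      using i(2) unfolding agree_def by fastforce
  qed (use z that in auto)
  have "E z"
    using ones by (intro parse_zero_after_ones[OF E(1) u(2) z(2)]) (auto simp: L_def)
  have "extend V m = extend V (m + z)" if "- int N \<le> m" "m \<le> int N" for m
  proof (cases "0 \<le> m")
    case True
    then have "extend V (z + m) = V (nat m)"
      using parse_at[OF E(1) \<open>E z\<close>, of m] built_from_prefix[OF u(1), of "nat m"] that u(3)
      by simp
    then show ?thesis
      using True by (simp add: extend_def algebra_simps)
  next
    case False
    then show ?thesis
      using ones[of "m + z"] that by (simp add: extend_def L_def)
  qed
  then show "\<exists>i\<ge>int N. agree {- int N..int N} (extend V) (\<lambda>m. extend V (m + i))"
    using z(1) i(1) by (intro exI[of _ z]) (auto simp: agree_def L_def)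
qed

end

section \<open>Automorphisms\<close>

locale rank1_automorphism = nondegenerate_rank1 +
  fixes \<tau> :: "(int \<Rightarrow> bool) \<Rightarrow> int \<Rightarrow> bool"
  assumes closed_under: "x \<in> X \<Longrightarrow> \<tau> x \<in> X"
    and injective: "inj_on \<tau> X"
    and continuous: "continuous_on X \<tau>"
    and commutes: "x \<in> X \<Longrightarrow> \<tau> (shift x) = shift (\<tau> x)"
begin

lemma commutes_translation:
  assumes "x \<in> X"
  shows "\<tau> (\<lambda>m. x (m + k)) = (\<lambda>m. \<tau> x (m + k))"
proof -
  have nonneg: "\<tau> (\<lambda>m. x (m + int n)) = (\<lambda>m. \<tau> x (m + int n))" if "x \<in> X" for n x
  proof (induction n)
    case (Suc n)
    have "\<tau> (shift (\<lambda>m. x (m + int n))) = shift (\<tau> (\<lambda>m. x (m + int n)))"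
      using rank1_system_shift[OF \<open>x \<in> X\<close>] by (rule commutes)
    then show ?case
      by (simp add: Suc shift_def algebra_simps)
  qed simp
  show ?thesis
  proof (cases "0 \<le> k")
    case True
    then show ?thesis using nonneg[OF assms, of "nat k"] by simp
  next
    case False
    have "\<tau> x = (\<lambda>m. \<tau> (\<lambda>m. x (m + k)) (m - k))"
      using nonneg[OF rank1_system_shift[OF assms, of k], of "nat (- k)"] False by simp
    then show ?thesis by (metis (no_types) add_diff_cancel_right')
  qed
qed

text \<open>Translations carry the window rule from coordinate 0 to every coordinate, with the same
  radius.\<close>

lemma local_rule:
  obtains R :: nat where "\<And>y z m. y \<in> X \<Longrightarrow> z \<in> X \<Longrightarrow>
    (\<And>k. m - int R \<le> k \<Longrightarrow> k \<le> m + int R \<Longrightarrow> y k = z k) \<Longrightarrow> \<tau> y m = \<tau> z m"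
proof -
  obtain R where R: "\<And>y z. y \<in> X \<Longrightarrow> z \<in> X \<Longrightarrow> agree {- int R..int R} y z \<Longrightarrow> \<tau> y 0 = \<tau> z 0"
    using sliding_block_code[OF closed_rank1_system continuous] by blast
  have "\<tau> y m = \<tau> z m"
    if "y \<in> X" "z \<in> X" and eq: "\<And>k. m - int R \<le> k \<Longrightarrow> k \<le> m + int R \<Longrightarrow> y k = z k" for y z m
  proof -
    have "\<tau> (\<lambda>k. y (k + m)) 0 = \<tau> (\<lambda>k. z (k + m)) 0"
      by (intro R rank1_system_shift that) (auto simp: agree_def intro!: eq)
    then show ?thesis
      by (simp add: commutes_translation that)
  qed
  then show ?thesis using that by blast
qed

text \<open>
  A point with tail \<open>V\<close> has a dense forward orbit, so the images of all points are determined
  by the tail of its image.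
\<close>

lemma power_of_shift_if_tails:
  assumes x: "x \<in> X" and c: "tail_at V x c" and d: "tail_at V (\<tau> x) d" and y: "y \<in> X"
  shows "\<tau> y = int_iterate shift (c - d) y"
proof
  fix m
  obtain R :: nat where R: "\<And>y z m. y \<in> X \<Longrightarrow> z \<in> X \<Longrightarrow>
      (\<And>k. m - int R \<le> k \<Longrightarrow> k \<le> m + int R \<Longrightarrow> y k = z k) \<Longrightarrow> \<tau> y m = \<tau> z m"
    using local_rule by blast
  \<comment> \<open>This radius covers the window around \<open>m\<close> and the position
    \<open>m + c - d\<close>, and keeps the indices into \<open>V\<close> nonnegative.\<close>
  define N where "N = nat (\<bar>m\<bar> + \<bar>c\<bar> + \<bar>d\<bar> + int R)"
  obtain i where i: "int N \<le> i" "agree {- int N..int N} y (\<lambda>m. extend V (m + i))"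
    using y mem_rank1_system_iff by blast
  have yi: "y k = extend V (k + i)" if "\<bar>k\<bar> \<le> \<bar>m\<bar> + \<bar>c\<bar> + \<bar>d\<bar> + int R" for k
  proof -
    have "k \<in> {- int N..int N}"
      using that unfolding N_def by auto
    then show ?thesis using i(2) by (simp add: agree_def)
  qed
  \<comment> \<open>Near \<open>m\<close>, both \<open>y\<close> and the translate of
    \<open>x\<close> by \<open>i + c\<close> read \<open>V\<close> at the same indices, so the local
    rule gives equal values; the tail of \<open>\<tau> x\<close> then evaluates them.\<close>
  have "\<tau> y m = \<tau> (\<lambda>m. x (m + (i + c))) m"
  proof (rule R[OF y rank1_system_shift[OF x]])
    fix k assume "m - int R \<le> k" "k \<le> m + int R"
    then have k: "\<bar>k\<bar> \<le> \<bar>m\<bar> + \<bar>c\<bar> + \<bar>d\<bar> + int R" by auto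
    then have "0 \<le> k + i" using i(1) by (auto simp: N_def)
    then have "x (k + i + c) = extend V (k + i)"
      using c by (simp add: tail_at_def)
    then show "y k = x (k + (i + c))"
      using yi[OF k] by (simp add: add.assoc)
  qed
  also have "\<dots> = \<tau> x ((m + i + c - d) + d)"
    by (simp add: commutes_translation x algebra_simps)
  also have "\<dots> = extend V (m + i + c - d)"
  proof -
    have "0 \<le> m + i + c - d"
      using i(1) by (auto simp: N_def)
    then show ?thesis using d unfolding tail_at_def by blast
  qed
  also have "\<dots> = y (m + (c - d))"
    by (subst yi) (auto simp: algebra_simps)
  finally show "\<tau> y m = int_iterate shift (c - d) y m"
    by (simp add: int_iterate_shift)
qed

section \<open>The two cases: unbounded and bounded runs of ones\<close>

lemma power_of_shift_unbounded:
  assumes one: "(\<lambda>_. True) \<in> X"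
  shows "\<exists>i. \<forall>x\<in>X. \<tau> x = int_iterate shift i x"
proof -
  \<comment> \<open>The image of a point fixed by the shift is constant, and the constant word 0 is
    not in \<open>X\<close>.\<close>
  have fixed: "\<tau> (\<lambda>_. True) = (\<lambda>_. True)"
  proof -
    have "\<tau> (\<lambda>_. True) k = \<tau> (\<lambda>_. True) 0" for k
      using fun_cong[OF commutes_translation[OF one, of k], of 0] by simp
    moreover have "\<tau> (\<lambda>_. True) \<noteq> (\<lambda>_. False)"
      using closed_under[OF one] zero_not_mem by auto
    ultimately show ?thesis by (metis (full_types) ext)
  qed
  obtain R :: nat where R: "\<And>y z m. y \<in> X \<Longrightarrow> z \<in> X \<Longrightarrow>
      (\<And>k. m - int R \<le> k \<Longrightarrow> k \<le> m + int R \<Longrightarrow> y k = z k) \<Longrightarrow> \<tau> y m = \<tau> z m"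
    using local_rule by blast
  have X: "extend V \<in> X"
    using one by (rule extend_mem)
  \<comment> \<open>There the window sees only the padding of \<open>extend V\<close>.\<close>
  have left: "\<tau> (extend V) m" if "m < - int R" for m
    using R[OF X one, of m] fixed that by (auto simp: extend_def)
  have "extend V \<noteq> (\<lambda>_. True)"
  proof -
    obtain u where "built_from V u" "u \<in> base_words"
      using long_base by blast
    then have "\<not> extend V 0"
      using built_from_parse parse_first by blast
    then show ?thesis by metis
  qed
  \<comment> \<open>Injectivity gives the image a zero, hence a first one, where
    \<open>tail_after_ones\<close> applies.\<close>
  then have "\<tau> (extend V) \<noteq> (\<lambda>_. True)"
    using inj_onD[OF injective _ X one] fixed by metis
  then obtain z where "\<not> \<tau> (extend V) z" by auto
  then have "\<exists>z\<ge>- int R. \<not> \<tau> (extend V) z"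
    using left by (metis not_le)
  then obtain c where "- int R \<le> c" "\<not> \<tau> (extend V) c"
      "\<And>m. - int R \<le> m \<Longrightarrow> m < c \<Longrightarrow> \<tau> (extend V) m"
    using first_zero_from by blast
  then have "tail_at V (\<tau> (extend V)) c"
    using left by (intro tail_after_ones closed_under X) (auto simp: not_le[symmetric])
  moreover have "tail_at V (extend V) 0"
    by (simp add: tail_at_def)
  ultimately show ?thesis
    using power_of_shift_if_tails[OF X] by blast
qed

text \<open>The local rule keeps the images of a right asymptotic pair asymptotic and injectivity
  keeps them distinct, so \<open>right_asymptotic_tail\<close> finds the tail \<open>V\<close> in
  \<open>\<tau> y\<close>.\<close>

lemma power_of_shift_bounded:
  assumes "(\<lambda>_. True) \<notin> X"
  shows "\<exists>i. \<forall>x\<in>X. \<tau> x = int_iterate shift i x"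
proof (cases "X = {}")
  case False
  then obtain x where x: "x \<in> X" by blast
  obtain B where B: "\<And>x m. x \<in> X \<Longrightarrow> \<exists>z. m \<le> z \<and> z \<le> m + B \<and> \<not> x z"
    using zeros_syndetic[OF assms] by blast
  obtain y z where yz: "y \<in> X" "z \<in> X" "y \<noteq> z" "tail_at V y 0" "tail_at V z 0"
    using right_asymptotic_pair[OF x B[OF x]] by blast
  obtain R :: nat where R: "\<And>y z m. y \<in> X \<Longrightarrow> z \<in> X \<Longrightarrow>
      (\<And>k. m - int R \<le> k \<Longrightarrow> k \<le> m + int R \<Longrightarrow> y k = z k) \<Longrightarrow> \<tau> y m = \<tau> z m"
    using local_rule by blast
  have "\<tau> y \<noteq> \<tau> z"
    using injective yz by (auto simp: inj_on_def)
  moreover have "\<tau> y m = \<tau> z m" if "int R \<le> m" for m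
    using yz that by (intro R) (auto simp: tail_at_def)
  moreover have "\<exists>z\<ge>m. \<not> \<tau> y z" for m
    using B[OF closed_under[OF yz(1)], of m] by blast
  ultimately obtain d where "tail_at V (\<tau> y) d"
    using right_asymptotic_tail[OF closed_under[OF yz(1)] closed_under[OF yz(2)]] by blast
  then show ?thesis
    using power_of_shift_if_tails[OF yz(1,4)] by blast
qed simp

end

theorem theorem1p2:
  fixes X :: "(int \<Rightarrow> bool) set"
    and \<tau> :: "(int \<Rightarrow> bool) \<Rightarrow> (int \<Rightarrow> bool)"
  assumes "nondegenerate_rank1_system X"
    and "homeomorphic_map (top_of_set X) (top_of_set X) \<tau>"
    and "\<forall>x\<in>X. \<tau> (shift x) = shift (\<tau> x)"
  shows "\<exists>i :: int. \<forall>x\<in>X. \<tau> x = int_iterate shift i x"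
proof -
  obtain V where V: "rank1_word V" "\<not> degenerate V" "X = rank1_system V"
    using assms(1) by (auto simp: nondegenerate_rank1_system_def)
  interpret rank1_automorphism V \<tau>
  proof
    show "\<tau> x \<in> rank1_system V" if "x \<in> rank1_system V" for x
      using homeomorphic_imp_surjective_map[OF assms(2)] that V(3) by auto
    show "inj_on \<tau> (rank1_system V)"
      using homeomorphic_imp_injective_map[OF assms(2)] V(3) by simp
    show "continuous_on (rank1_system V) \<tau>"
      using homeomorphic_imp_continuous_map[OF assms(2)] V(3) by auto
    show "\<tau> (shift x) = shift (\<tau> x)" if "x \<in> rank1_system V" for x
      using assms(3) that V(3) by blast
  qed (use V in auto)
  show ?thesis
    unfolding V(3) using power_of_shift_unbounded power_of_shift_bounded by blast
qed

end
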